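(* There exist finitely generated groups $\Delta$ and $\Gamma$ such that $\Gamma$ is non-Hopfian but $\Delta\wr\Gamma$ is Hopfian.
   Context: The (standard, restricted) wreath product is $\Delta\wr\Gamma:=\left(\bigoplus_\Gamma\Delta\right)\rtimes\Gamma$, where $\bigoplus_\Gamma\Delta$ is the group of finitely supported functions $f\colon\Gamma\to\Delta$ and $\Gamma$ acts by $({}_\gamma f)(x)=f(\gamma^{-1}x)$. A group is Hopfian if every surjective endomorphism of it is an automorphism. *)

theory Defs
  imports "HOL-Algebra.Product_Groups"
begin

definition finitely_generated :: "('a, 'm) monoid_scheme \<Rightarrow> bool" where
  "finitely_generated G \<longleftrightarrow> (\<exists>S. finite S \<and> S \<subseteq> carrier G \<and> generate G S = carrier G)"

text \<open>Automorphisms are elements of \<^term>\<open>iso G G\<close> rather than of the library's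
  \<open>auto G\<close>, because the latter consists of extensional functions only, whereas \<^term>\<open>epi G G\<close>
  puts no condition on values outside the carrier.\<close>

definition hopfian :: "('a, 'm) monoid_scheme \<Rightarrow> bool" where
  "hopfian G \<longleftrightarrow> (\<forall>h \<in> epi G G. h \<in> iso G G)"

definition semidirect_product ::
    "('n, 'm) monoid_scheme \<Rightarrow> ('g, 'k) monoid_scheme \<Rightarrow> ('g \<Rightarrow> 'n \<Rightarrow> 'n) \<Rightarrow> ('n \<times> 'g) monoid" where
  "semidirect_product N G \<phi> =
    \<lparr>carrier = carrier N \<times> carrier G,
     monoid.mult = (\<lambda>(f, a) (g, b). (f \<otimes>\<^bsub>N\<^esub> \<phi> a g, a \<otimes>\<^bsub>G\<^esub> b)),
     one = (\<one>\<^bsub>N\<^esub>, \<one>\<^bsub>G\<^esub>)\<rparr>"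

definition translate ::
    "('g, 'k) monoid_scheme \<Rightarrow> 'g \<Rightarrow> ('g \<Rightarrow> 'd) \<Rightarrow> ('g \<Rightarrow> 'd)" where
  "translate G a f = (\<lambda>x \<in> carrier G. f (inv\<^bsub>G\<^esub> a \<otimes>\<^bsub>G\<^esub> x))"

definition wreath_product ::
    "('d, 'm) monoid_scheme \<Rightarrow> ('g, 'k) monoid_scheme \<Rightarrow> (('g \<Rightarrow> 'd) \<times> 'g) monoid" where
  "wreath_product D G =
    semidirect_product (sum_group (carrier G) (\<lambda>_. D)) G (translate G)"

lemma group_semidirect_product:
  assumes N: "group N" and G: "group G"
    and hom: "\<And>a. a \<in> carrier G \<Longrightarrow> \<phi> a \<in> hom N N"
    and one: "\<And>f. f \<in> carrier N \<Longrightarrow> \<phi> \<one>\<^bsub>G\<^esub> f = f"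
    and mult: "\<And>a b f. \<lbrakk>a \<in> carrier G; b \<in> carrier G; f \<in> carrier N\<rbrakk>
                 \<Longrightarrow> \<phi> (a \<otimes>\<^bsub>G\<^esub> b) f = \<phi> a (\<phi> b f)"
  shows "group (semidirect_product N G \<phi>)"
proof -
  interpret N: group N by (rule N)
  interpret G: group G by (rule G)
  have cl: "\<phi> a f \<in> carrier N" if "a \<in> carrier G" "f \<in> carrier N" for a f
    using hom[OF that(1)] that(2) by (auto simp: hom_def)
  have dist: "\<phi> a (f \<otimes>\<^bsub>N\<^esub> g) = \<phi> a f \<otimes>\<^bsub>N\<^esub> \<phi> a g"
    if "a \<in> carrier G" "f \<in> carrier N" "g \<in> carrier N" for a f g
    using hom[OF that(1)] that(2,3) by (auto simp: hom_def)
  show ?thesis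
  proof (rule groupI)
    fix x assume "x \<in> carrier (semidirect_product N G \<phi>)"
    then obtain f a where x: "x = (f, a)" "f \<in> carrier N" "a \<in> carrier G"
      by (auto simp: semidirect_product_def)
    let ?y = "(\<phi> (inv\<^bsub>G\<^esub> a) (inv\<^bsub>N\<^esub> f), inv\<^bsub>G\<^esub> a)"
    have "\<phi> (inv\<^bsub>G\<^esub> a) \<one>\<^bsub>N\<^esub> = \<one>\<^bsub>N\<^esub>"
      using hom_one[OF hom N N] x by simp
    then have "\<phi> (inv\<^bsub>G\<^esub> a) (inv\<^bsub>N\<^esub> f) \<otimes>\<^bsub>N\<^esub> \<phi> (inv\<^bsub>G\<^esub> a) f = \<one>\<^bsub>N\<^esub>"
      using x by (simp flip: dist)
    then show "\<exists>y \<in> carrier (semidirect_product N G \<phi>).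
        y \<otimes>\<^bsub>semidirect_product N G \<phi>\<^esub> x = \<one>\<^bsub>semidirect_product N G \<phi>\<^esub>"
      using x cl by (intro bexI[of _ ?y]) (auto simp: semidirect_product_def)
  qed (auto simp: semidirect_product_def cl dist one mult N.m_assoc G.m_assoc)
qed

lemma group_wreath_product:
  assumes D: "group D" and G: "group G"
  shows "group (wreath_product D G)"
proof -
  interpret D: group D by (rule D)
  interpret G: group G by (rule G)
  let ?N = "sum_group (carrier G) (\<lambda>_. D)"
  have car: "carrier ?N =
      {f \<in> carrier G \<rightarrow>\<^sub>E carrier D. finite {x \<in> carrier G. f x \<noteq> \<one>\<^bsub>D\<^esub>}}"
    using D by (simp add: carrier_sum_group)
  have closed: "translate G a f \<in> carrier ?N" if a: "a \<in> carrier G" and f: "f \<in> carrier ?N" for a f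
  proof -
    have "{x \<in> carrier G. translate G a f x \<noteq> \<one>\<^bsub>D\<^esub>}
        \<subseteq> (\<lambda>x. a \<otimes>\<^bsub>G\<^esub> x) ` {x \<in> carrier G. f x \<noteq> \<one>\<^bsub>D\<^esub>}"
    proof
      fix x assume "x \<in> {x \<in> carrier G. translate G a f x \<noteq> \<one>\<^bsub>D\<^esub>}"
      then show "x \<in> (\<lambda>x. a \<otimes>\<^bsub>G\<^esub> x) ` {x \<in> carrier G. f x \<noteq> \<one>\<^bsub>D\<^esub>}"
        using a by (intro image_eqI[of _ _ "inv\<^bsub>G\<^esub> a \<otimes>\<^bsub>G\<^esub> x"])
          (auto simp: translate_def simp flip: G.m_assoc)
    qed
    moreover have "finite {x \<in> carrier G. f x \<noteq> \<one>\<^bsub>D\<^esub>}" using f by (simp add: car)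
    ultimately have "finite {x \<in> carrier G. translate G a f x \<noteq> \<one>\<^bsub>D\<^esub>}"
      by (meson finite_imageI finite_subset)
    then show ?thesis using a f by (auto simp: car translate_def)
  qed
  show ?thesis
    unfolding wreath_product_def
  proof (rule group_semidirect_product)
    show "group ?N" using D by simp
    show "group G" by (rule G)
    show "translate G a \<in> hom ?N ?N" if "a \<in> carrier G" for a
      using that closed by (intro homI) (auto simp: translate_def fun_eq_iff)
    show "translate G \<one>\<^bsub>G\<^esub> f = f" if "f \<in> carrier ?N" for f
      using that by (auto simp: car translate_def fun_eq_iff PiE_def extensional_def)
    show "translate G (a \<otimes>\<^bsub>G\<^esub> b) f = translate G a (translate G b f)"
      if "a \<in> carrier G" "b \<in> carrier G" "f \<in> carrier ?N" for a b f
      using that by (auto simp: translate_def fun_eq_iff G.inv_mult_group G.m_assoc)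
  qed
qed

end

theory Submission
  imports Defs "HOL-Algebra.Sym_Groups" "HOL-Algebra.SimpleGroups" "HOL-Algebra.Weak_Morphisms"
begin

text \<open>Let \<open>D\<close> be finite, simple and nonabelian, and let \<open>G\<close> be solvable. A surjective
  endomorphism \<open>\<phi>\<close> of the wreath product of \<open>D\<close> by \<open>G\<close> is then injective, whether or not \<open>G\<close> is Hopfian (\<open>hopfian_wreath_product\<close>).
  Indeed, \<open>D\<close> has no nontrivial homomorphism to a solvable group, so \<open>\<phi>\<close> maps the base, the direct
  sum of copies of \<open>D\<close>, into itself, and in fact onto itself (\<open>base_in_range_of_surjection\<close>). A
  surjection from a direct sum of copies of \<open>D\<close> to \<open>D\<close> has the same kernel as a coordinate projection,
  since commuting subgroups of \<open>D\<close> cannot both be all of \<open>D\<close> (\<open>surjection_from_power_is_coordinate\<close>).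
  Hence \<open>\<phi>\<close> remembers the coordinates of the base, on which \<open>G\<close> acts freely and transitively: a
  kernel element cannot move a coordinate, so it lies in the base, and there it vanishes at each
  coordinate. In particular no non-injective endomorphism of \<open>G\<close> lies below \<open>\<phi>\<close>: it would identify
  coordinates, and identified copies of \<open>D\<close> would have to commute with themselves.

  It remains to choose \<open>D\<close> as a finite simple nonabelian group, obtained as an unsolvable group of
  least order (\<open>exists_simple_unsolvable_group\<close>), and \<open>G\<close> as a finitely generated solvable group that
  is not Hopfian. Finitely generated metabelian groups are residually finite and thus Hopfian; a
  classical example one step above them is P. Hall's group of triangular \<open>3 \<times> 3\<close> matrices over the
  dyadic rationals, with the integers in its centre factored out. Doubling the central entry is
  surjective there but kills the class of \<open>1/2\<close> (\<open>hall_not_hopfian\<close>).\<close>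

section \<open>Restricted powers\<close>

abbreviation restricted_power :: "'i set \<Rightarrow> ('d, 'm) monoid_scheme \<Rightarrow> ('i \<Rightarrow> 'd) monoid" where
  "restricted_power I D \<equiv> sum_group I (\<lambda>_. D)"

definition single :: "'i set \<Rightarrow> ('d, 'm) monoid_scheme \<Rightarrow> 'i \<Rightarrow> 'd \<Rightarrow> ('i \<Rightarrow> 'd)" where
  "single I D i d = (\<lambda>j\<in>I. if j = i then d else \<one>\<^bsub>D\<^esub>)"

lemma (in group) restricted_power_carrier_iff:
  "f \<in> carrier (restricted_power I G) \<longleftrightarrow>
     f \<in> extensional I \<and> (\<forall>i\<in>I. f i \<in> carrier G) \<and> finite {i \<in> I. f i \<noteq> \<one>}"
  by (auto simp: carrier_sum_group is_group PiE_iff)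

lemma (in group) restricted_power_is_group: "group (restricted_power I G)"
  by (simp add: is_group)

lemma (in group) single_in_carrier:
  assumes "i \<in> I" "d \<in> carrier G"
  shows "single I G i d \<in> carrier (restricted_power I G)"
proof -
  have "{j \<in> I. single I G i d j \<noteq> \<one>} \<subseteq> {i}" by (auto simp: single_def)
  then show ?thesis using assms finite_subset
    by (fastforce simp: restricted_power_carrier_iff single_def)
qed

lemma (in group) single_hom:
  assumes "i \<in> I"
  shows "single I G i \<in> hom G (restricted_power I G)"
  using assms by (auto intro!: homI single_in_carrier simp: single_def fun_eq_iff)

text \<open>An element of a restricted power has finite support, so it is a finite product of elements
  supported at one index; the proof removes one index of the support at a time. Triviality
  is required on the support of \<open>f\<close> only, so that the lemma also applies to homomorphisms that kill
  all but one of the coordinate subgroups.\<close>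

lemma (in group) hom_trivial_on_singles:
  assumes H: "group H" and h: "h \<in> hom (restricted_power I G) H"
    and triv: "\<And>i d. \<lbrakk>i \<in> I; d \<in> carrier G; f i \<noteq> \<one>\<rbrakk> \<Longrightarrow> h (single I G i d) = \<one>\<^bsub>H\<^esub>"
    and f: "f \<in> carrier (restricted_power I G)"
  shows "h f = \<one>\<^bsub>H\<^esub>"
proof -
  interpret H: group H by (rule H)
  define S where "S = {i \<in> I. f i \<noteq> \<one>}"
  have "finite S" using f by (simp add: S_def restricted_power_carrier_iff)
  have "\<lbrakk>g \<in> carrier (restricted_power I G); {i \<in> I. g i \<noteq> \<one>} \<subseteq> T; T \<subseteq> S\<rbrakk> \<Longrightarrow> h g = \<one>\<^bsub>H\<^esub>"
    if "finite T" for g T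
    using that
  proof (induction T arbitrary: g rule: finite_induct)
    case empty
    then have "g = \<one>\<^bsub>restricted_power I G\<^esub>"
      by (auto simp: restricted_power_carrier_iff fun_eq_iff extensional_def)
    then show ?case
      using hom_one[OF h restricted_power_is_group H] by (simp del: one_sum_group)
  next
    case (insert i T)
    have i: "i \<in> I" "f i \<noteq> \<one>" using insert.prems by (auto simp: S_def)
    let ?g = "\<lambda>j\<in>I. if j = i then \<one> else g j"
    have gi: "g i \<in> carrier G" using insert.prems i by (simp add: restricted_power_carrier_iff)
    have "finite {j \<in> I. ?g j \<noteq> \<one>}"
      using insert.prems by (auto simp: restricted_power_carrier_iff elim!: rev_finite_subset)
    then have g': "?g \<in> carrier (restricted_power I G)"
      using insert.prems by (auto simp: restricted_power_carrier_iff)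
    have supp: "{j \<in> I. ?g j \<noteq> \<one>} \<subseteq> T" using insert.prems by auto
    have hg': "h ?g = \<one>\<^bsub>H\<^esub>" by (rule insert.IH) (use insert.prems g' supp in \<open>simp_all del: restrict_apply\<close>)
    have "g = single I G i (g i) \<otimes>\<^bsub>restricted_power I G\<^esub> ?g"
      using insert.prems gi
      by (auto simp: restricted_power_carrier_iff fun_eq_iff extensional_def single_def)
    then have "h g = h (single I G i (g i)) \<otimes>\<^bsub>H\<^esub> h ?g"
      using hom_mult[OF h single_in_carrier[OF i(1) gi] g'] by simp
    then show ?case using triv[OF i(1) gi i(2)] hg' by simp
  qed
  from this[OF \<open>finite S\<close> f] show ?thesis by (auto simp: S_def)
qed

section \<open>Simple unsolvable groups\<close>

lemma (in comm_group) comm_group_solvable: "solvable G"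
proof -
  have "(derived G ^^ 1) (carrier G) = {\<one>}" by (simp add: derived_eq_singleton)
  then show ?thesis using solvable_iff_trivial_derived_seq by blast
qed

text \<open>The kernel is everything or trivial, and in the second case \<open>D\<close> would embed into a solvable
  group.\<close>

lemma hom_simple_unsolvable_to_solvable_trivial:
  assumes D: "simple_group D" "\<not> solvable D" and G: "group G" "solvable G"
    and h: "h \<in> hom D G" and d: "d \<in> carrier D"
  shows "h d = \<one>\<^bsub>G\<^esub>"
proof -
  interpret D: simple_group D by (rule D)
  interpret h: group_hom D G h
    using D.is_group G h by (simp add: group_hom_def group_hom_axioms_def)
  have "kernel D G h \<noteq> {\<one>\<^bsub>D\<^esub>}"
    using h.inj_hom_imp_solvable h.trivial_ker_imp_inj G D by blast
  then have "kernel D G h = carrier D"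
    using D.no_real_normal_subgroup h.normal_kernel by blast
  then show ?thesis using d by (auto simp: kernel_def)
qed

text \<open>Surjectivity of \<open>h\<close> makes the image of each coordinate subgroup normal in \<open>D\<close>, hence trivial
  or all of \<open>D\<close>. Images of different coordinates commute, so two of them cannot both be the nonabelian
  group \<open>D\<close>; and they cannot all be trivial. So \<open>h\<close> depends on a single coordinate \<open>i\<close> only, and on
  that coordinate it is injective because \<open>D\<close> is simple.\<close>

lemma surjection_from_power_is_coordinate:
  assumes D: "simple_group D" "\<not> solvable D"
    and h: "h \<in> epi (restricted_power I D) D"
  shows "\<exists>i\<in>I. \<forall>f\<in>carrier (restricted_power I D). h f = \<one>\<^bsub>D\<^esub> \<longleftrightarrow> f i = \<one>\<^bsub>D\<^esub>"
proof -
  interpret D: simple_group D by (rule D)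
  let ?P = "restricted_power I D"
  have hom: "h \<in> hom ?P D" and surj: "h ` carrier ?P = carrier D"
    using h by (auto simp: epi_def)
  define \<alpha> where "\<alpha> i d = h (single I D i d)" for i d
  have \<alpha>_hom: "\<alpha> i \<in> hom D D" if "i \<in> I" for i
    using hom_compose[OF D.single_hom[OF that] hom] by (simp add: \<alpha>_def[abs_def] comp_def)
  have \<alpha>_group_hom: "group_hom D D (\<alpha> i)" if "i \<in> I" for i
    using \<alpha>_hom[OF that] D.is_group by (simp add: group_hom_def group_hom_axioms_def)
  have image_normal: "\<alpha> i ` carrier D \<lhd> D" if i: "i \<in> I" for i
  proof -
    have "x \<otimes>\<^bsub>D\<^esub> y \<otimes>\<^bsub>D\<^esub> inv\<^bsub>D\<^esub> x \<in> \<alpha> i ` carrier D" if x: "x \<in> carrier D" and y: "y \<in> \<alpha> i ` carrier D" for x y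
    proof -
      obtain f where f: "f \<in> carrier ?P" "x = h f" using x surj by auto
      obtain d where d: "d \<in> carrier D" "y = \<alpha> i d" using y by auto
      have fi: "f i \<in> carrier D" using f i by (simp add: D.restricted_power_carrier_iff)
      \<comment> \<open>Conjugation by \<open>f\<close> acts on the coordinate subgroup at \<open>i\<close> as conjugation by \<open>f i\<close>.\<close>
      let ?e = "f i \<otimes>\<^bsub>D\<^esub> d \<otimes>\<^bsub>D\<^esub> inv\<^bsub>D\<^esub> (f i)"
      have e: "?e \<in> carrier D" using fi d by simp
      have "f \<otimes>\<^bsub>?P\<^esub> single I D i d = single I D i ?e \<otimes>\<^bsub>?P\<^esub> f"
        using f i d fi by (auto simp: single_def fun_eq_iff D.restricted_power_carrier_iff D.m_assoc)
      then have "x \<otimes>\<^bsub>D\<^esub> y = \<alpha> i ?e \<otimes>\<^bsub>D\<^esub> x"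
        unfolding \<alpha>_def f(2) d(2)
        using hom_mult[OF hom f(1) D.single_in_carrier[OF i d(1)]]
          hom_mult[OF hom D.single_in_carrier[OF i e] f(1)] by metis
      then have "x \<otimes>\<^bsub>D\<^esub> y \<otimes>\<^bsub>D\<^esub> inv\<^bsub>D\<^esub> x = \<alpha> i ?e"
        using x e group_hom.hom_closed[OF \<alpha>_group_hom[OF i] e] by (simp add: D.m_assoc)
      then show ?thesis using e by blast
    qed
    moreover have "subgroup (\<alpha> i ` carrier D) D"
      using group_hom.img_is_subgroup[OF \<alpha>_group_hom[OF i]] .
    ultimately show ?thesis by (simp add: D.normal_inv_iff)
  qed
  have dichotomy: "\<alpha> i ` carrier D = carrier D \<or> \<alpha> i ` carrier D = {\<one>\<^bsub>D\<^esub>}" if "i \<in> I" for i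
    using D.no_real_normal_subgroup[OF image_normal[OF that]] .
  have commute: "\<alpha> i d \<otimes>\<^bsub>D\<^esub> \<alpha> j e = \<alpha> j e \<otimes>\<^bsub>D\<^esub> \<alpha> i d"
    if "i \<in> I" "j \<in> I" "i \<noteq> j" "d \<in> carrier D" "e \<in> carrier D" for i j d e
  proof -
    have "single I D i d \<otimes>\<^bsub>?P\<^esub> single I D j e = single I D j e \<otimes>\<^bsub>?P\<^esub> single I D i d"
      using that by (auto simp: single_def fun_eq_iff)
    then show ?thesis
      unfolding \<alpha>_def
      using hom_mult[OF hom D.single_in_carrier[OF that(1,4)] D.single_in_carrier[OF that(2,5)]]
        hom_mult[OF hom D.single_in_carrier[OF that(2,5)] D.single_in_carrier[OF that(1,4)]]
      by metis
  qed
  have "\<exists>i\<in>I. \<alpha> i ` carrier D \<noteq> {\<one>\<^bsub>D\<^esub>}"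
  proof (rule ccontr)
    assume none: "\<not> ?thesis"
    have "h (single I D i d) = \<one>\<^bsub>D\<^esub>" if "i \<in> I" "d \<in> carrier D" for i d
      using none that unfolding \<alpha>_def by blast
    then have "h f = \<one>\<^bsub>D\<^esub>" if "f \<in> carrier ?P" for f
      using D.hom_trivial_on_singles[OF D.is_group hom _ that] by blast
    then have "h ` carrier ?P \<subseteq> {\<one>\<^bsub>D\<^esub>}" by blast
    then have "carrier D = {\<one>\<^bsub>D\<^esub>}" unfolding surj using D.one_closed by blast
    then show False using D.simple_not_triv by blast
  qed
  then obtain i where i: "i \<in> I" and nontriv: "\<alpha> i ` carrier D \<noteq> {\<one>\<^bsub>D\<^esub>}" ..
  then have onto: "\<alpha> i ` carrier D = carrier D" using dichotomy[OF i] by simp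
  have other: "\<alpha> j ` carrier D = {\<one>\<^bsub>D\<^esub>}" if j: "j \<in> I" "j \<noteq> i" for j
  proof (rule ccontr)
    assume "\<not> ?thesis"
    then have "\<alpha> j ` carrier D = carrier D" using dichotomy[OF j(1)] by simp
    then have "x \<otimes>\<^bsub>D\<^esub> y = y \<otimes>\<^bsub>D\<^esub> x" if "x \<in> carrier D" "y \<in> carrier D" for x y
    proof -
      obtain d where d: "d \<in> carrier D" "x = \<alpha> i d"
        using \<open>x \<in> carrier D\<close> onto by blast
      obtain e where e: "e \<in> carrier D" "y = \<alpha> j e"
        using \<open>y \<in> carrier D\<close> \<open>\<alpha> j ` carrier D = carrier D\<close> by blast
      show ?thesis
        unfolding d(2) e(2) by (rule commute[OF i j(1) j(2)[symmetric] d(1) e(1)])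
    qed
    then have "comm_group D" by (rule D.group_comm_groupI)
    then show False using comm_group.comm_group_solvable[of D] D(2) by simp
  qed
  have "kernel D D (\<alpha> i) \<noteq> carrier D"
  proof
    assume "kernel D D (\<alpha> i) = carrier D"
    then have "\<alpha> i d = \<one>\<^bsub>D\<^esub>" if "d \<in> carrier D" for d
      using that by (auto simp: kernel_def)
    then have "\<alpha> i ` carrier D = {\<one>\<^bsub>D\<^esub>}" using D.one_closed by force
    then show False using nontriv by blast
  qed
  then have ker: "kernel D D (\<alpha> i) = {\<one>\<^bsub>D\<^esub>}"
    using D.no_real_normal_subgroup[OF group_hom.normal_kernel[OF \<alpha>_group_hom[OF i]]] by simp
  have "h f = \<one>\<^bsub>D\<^esub> \<longleftrightarrow> f i = \<one>\<^bsub>D\<^esub>" if f: "f \<in> carrier ?P" for f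
  proof -
    let ?g = "\<lambda>j\<in>I. if j = i then \<one>\<^bsub>D\<^esub> else f j"
    have fi: "f i \<in> carrier D" using f i by (simp add: D.restricted_power_carrier_iff)
    have "finite {j \<in> I. ?g j \<noteq> \<one>\<^bsub>D\<^esub>}"
      using f by (auto simp: D.restricted_power_carrier_iff elim!: rev_finite_subset)
    then have g: "?g \<in> carrier ?P"
      using f by (auto simp: D.restricted_power_carrier_iff)
    have "h ?g = \<one>\<^bsub>D\<^esub>"
    proof (rule D.hom_trivial_on_singles[OF D.is_group hom _ g])
      fix j d assume j: "j \<in> I" "d \<in> carrier D" "?g j \<noteq> \<one>\<^bsub>D\<^esub>"
      then have "j \<noteq> i" by auto
      then show "h (single I D j d) = \<one>\<^bsub>D\<^esub>" using other[of j] j by (auto simp: \<alpha>_def)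
    qed
    moreover have "f = single I D i (f i) \<otimes>\<^bsub>?P\<^esub> ?g"
      using f fi by (auto simp: D.restricted_power_carrier_iff fun_eq_iff extensional_def single_def)
    then have "h f = \<alpha> i (f i) \<otimes>\<^bsub>D\<^esub> h ?g"
      unfolding \<alpha>_def using hom_mult[OF hom D.single_in_carrier[OF i fi] g] by metis
    ultimately have "h f = \<alpha> i (f i)"
      using group_hom.hom_closed[OF \<alpha>_group_hom[OF i] fi] by simp
    then show ?thesis using ker fi by (auto simp: kernel_def)
  qed
  then show ?thesis using i by blast
qed

section \<open>Wreath products of simple groups by solvable groups\<close>

lemma wreath_product_carrier:
  "carrier (wreath_product D G) = carrier (restricted_power (carrier G) D) \<times> carrier G"
  by (simp add: wreath_product_def semidirect_product_def)

lemma wreath_product_mult: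
  "(f, a) \<otimes>\<^bsub>wreath_product D G\<^esub> (g, b) =
     (f \<otimes>\<^bsub>restricted_power (carrier G) D\<^esub> translate G a g, a \<otimes>\<^bsub>G\<^esub> b)"
  by (simp add: wreath_product_def semidirect_product_def)

lemma wreath_product_one:
  "\<one>\<^bsub>wreath_product D G\<^esub> = (\<one>\<^bsub>restricted_power (carrier G) D\<^esub>, \<one>\<^bsub>G\<^esub>)"
  by (simp add: wreath_product_def semidirect_product_def)

lemma translate_one:
  assumes "group G" "f \<in> extensional (carrier G)"
  shows "translate G \<one>\<^bsub>G\<^esub> f = f"
proof -
  interpret group G by fact
  show ?thesis using assms(2) by (auto simp: translate_def extensional_def)
qed

lemma translate_unit:
  assumes "group G" "a \<in> carrier G"
  shows "translate G a (\<lambda>x\<in>carrier G. d) = (\<lambda>x\<in>carrier G. d)"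
proof -
  interpret group G by fact
  show ?thesis using assms(2) by (auto simp: translate_def)
qed

lemma translate_single:
  assumes "group G" "a \<in> carrier G" "x \<in> carrier G"
  shows "translate G a (single (carrier G) D x d) = single (carrier G) D (a \<otimes>\<^bsub>G\<^esub> x) d"
proof -
  interpret group G by fact
  have "inv\<^bsub>G\<^esub> a \<otimes>\<^bsub>G\<^esub> y = x \<longleftrightarrow> y = a \<otimes>\<^bsub>G\<^esub> x" if "y \<in> carrier G" for y
    using that assms(2,3) by (metis inv_closed inv_solve_left')
  then show ?thesis using assms(2,3) by (auto simp: translate_def single_def)
qed

text \<open>The product \<open>(1, a) (f, 1) = (translate G a f, a)\<close> stays in the wreath product, which is
  known to be a group, so finiteness of the translated support comes for free.\<close>

lemma translate_closed:
  assumes D: "group D" and G: "group G" and a: "a \<in> carrier G"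
    and f: "f \<in> carrier (restricted_power (carrier G) D)"
  shows "translate G a f \<in> carrier (restricted_power (carrier G) D)"
proof -
  interpret D: group D by (rule D)
  interpret G: group G by (rule G)
  interpret W: group "wreath_product D G" by (rule group_wreath_product[OF D G])
  let ?one = "\<one>\<^bsub>restricted_power (carrier G) D\<^esub>"
  have "?one \<in> carrier (restricted_power (carrier G) D)"
    using group.is_monoid[OF D.restricted_power_is_group] by (rule monoid.one_closed)
  then have "(?one, a) \<otimes>\<^bsub>wreath_product D G\<^esub> (f, \<one>\<^bsub>G\<^esub>) \<in> carrier (wreath_product D G)"
    using a f by (intro W.m_closed) (simp_all add: wreath_product_carrier)
  then have "?one \<otimes>\<^bsub>restricted_power (carrier G) D\<^esub> translate G a f \<in> carrier (restricted_power (carrier G) D)"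
    by (simp add: wreath_product_mult wreath_product_carrier del: one_sum_group mult_sum_group)
  moreover have "?one \<otimes>\<^bsub>restricted_power (carrier G) D\<^esub> translate G a f = translate G a f"
    using a f by (auto simp: translate_def D.restricted_power_carrier_iff)
  ultimately show ?thesis by simp
qed

lemma wreath_base_hom:
  assumes "group D" "group G"
  shows "(\<lambda>f. (f, \<one>\<^bsub>G\<^esub>)) \<in> hom (restricted_power (carrier G) D) (wreath_product D G)"
proof -
  interpret D: group D by fact
  interpret G: group G by fact
  show ?thesis
    by (rule homI) (auto simp: wreath_product_carrier wreath_product_mult translate_one[OF assms(2)]
       D.restricted_power_carrier_iff)
qed

lemma wreath_quotient_hom: "snd \<in> hom (wreath_product D G) G"
  by (auto intro!: homI simp: wreath_product_carrier wreath_product_mult)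

lemma wreath_complement_hom:
  assumes "group D" "group G"
  shows "(\<lambda>a. (\<one>\<^bsub>restricted_power (carrier G) D\<^esub>, a)) \<in> hom G (wreath_product D G)"
proof -
  interpret D: group D by fact
  interpret G: group G by fact
  show ?thesis
  proof (rule homI)
    fix a assume "a \<in> carrier G"
    then show "(\<one>\<^bsub>restricted_power (carrier G) D\<^esub>, a) \<in> carrier (wreath_product D G)"
      unfolding wreath_product_carrier
      using group.is_monoid[OF D.restricted_power_is_group] by (blast intro: monoid.one_closed)
  qed (auto simp: wreath_product_mult translate_unit[OF assms(2)])
qed

lemma wreath_base_normal:
  assumes "group D" "group G"
  shows "carrier (restricted_power (carrier G) D) \<times> {\<one>\<^bsub>G\<^esub>} \<lhd> wreath_product D G"
proof -
  have "group_hom (wreath_product D G) G snd"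
    using group_wreath_product[OF assms] assms(2) wreath_quotient_hom
    by (simp add: group_hom_def group_hom_axioms_def)
  moreover have "kernel (wreath_product D G) G snd = carrier (restricted_power (carrier G) D) \<times> {\<one>\<^bsub>G\<^esub>}"
    using group.is_monoid[OF assms(2)] by (auto simp: kernel_def wreath_product_carrier)
  ultimately show ?thesis by (metis group_hom.normal_kernel)
qed

lemma wreath_product_factorization:
  assumes D: "group D" and G: "group G" and f: "f \<in> carrier (restricted_power (carrier G) D)" "a \<in> carrier G"
  shows "(f, a) = (f, \<one>\<^bsub>G\<^esub>) \<otimes>\<^bsub>wreath_product D G\<^esub> (\<one>\<^bsub>restricted_power (carrier G) D\<^esub>, a)"
proof -
  interpret D: group D by (rule D)
  interpret G: group G by (rule G)
  show ?thesis
    using f by (auto simp: wreath_product_mult translate_unit[OF G] D.restricted_power_carrier_iff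
       fun_eq_iff extensional_def)
qed

text \<open>Modulo the image \<open>N\<close> of the base, the whole wreath product is the image of the complement \<open>G\<close>,
  because \<open>\<phi>\<close> is surjective. So the quotient by \<open>N\<close> is solvable, each coordinate copy of \<open>D\<close> dies
  in it, and therefore the base is contained in \<open>N\<close>.\<close>

lemma base_in_range_of_surjection:
  assumes D: "simple_group D" "\<not> solvable D" and G: "group G" "solvable G"
    and \<phi>: "\<phi> \<in> epi (wreath_product D G) (wreath_product D G)"
    and s: "s \<in> carrier (restricted_power (carrier G) D)"
  shows "\<exists>f\<in>carrier (restricted_power (carrier G) D). \<phi> (f, \<one>\<^bsub>G\<^esub>) = (s, \<one>\<^bsub>G\<^esub>)"
proof -
  let ?W = "wreath_product D G" and ?P = "restricted_power (carrier G) D"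
  interpret D: simple_group D by (rule D)
  interpret G: group G by (rule G)
  interpret W: group ?W by (rule group_wreath_product[OF D.is_group G(1)])
  have hom: "\<phi> \<in> hom ?W ?W" and surj: "\<phi> ` carrier ?W = carrier ?W"
    using \<phi> by (auto simp: epi_def)
  define N where "N = \<phi> ` (carrier ?P \<times> {\<one>\<^bsub>G\<^esub>})"
  interpret N: normal N ?W
    unfolding N_def
    by (rule normal.surj_hom_normal_subgroup[OF wreath_base_normal[OF D.is_group G(1)]])
      (use hom surj W.is_group in \<open>simp_all add: group_hom_def group_hom_axioms_def\<close>)
  let ?Q = "?W Mod N" and ?p = "r_coset ?W N"
  have Q: "group ?Q" by (rule N.factorgroup_is_group)
  have p_hom: "?p \<in> hom ?W ?Q" by (rule N.r_coset_hom_Mod)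
  have p_N: "?p n = \<one>\<^bsub>?Q\<^esub>" if "n \<in> N" for n
    using W.coset_join2[OF _ N.subgroup_axioms that] N.subset that by auto
  define c where "c a = (\<one>\<^bsub>?P\<^esub>, a)" for a :: 'c
  have c_hom: "c \<in> hom G ?W"
    using wreath_complement_hom[OF D.is_group G(1)] by (simp only: c_def[abs_def])
  have q_hom: "?p \<circ> (\<phi> \<circ> c) \<in> hom G ?Q"
    by (intro Group.hom_compose[OF Group.hom_compose[OF c_hom hom] p_hom])
  have "?p w \<in> (?p \<circ> (\<phi> \<circ> c)) ` carrier G" if "w \<in> carrier ?W" for w
  proof -
    have "w \<in> \<phi> ` (carrier ?P \<times> carrier G)"
      using that surj by (simp add: wreath_product_carrier)
    then obtain f a where f: "f \<in> carrier ?P" and a: "a \<in> carrier G" and w: "w = \<phi> (f, a)"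
      by blast
    have f': "(f, \<one>\<^bsub>G\<^esub>) \<in> carrier ?W" using f by (simp add: wreath_product_carrier)
    have a': "c a \<in> carrier ?W" using hom_in_carrier[OF c_hom a] .
    have "w = \<phi> (f, \<one>\<^bsub>G\<^esub>) \<otimes>\<^bsub>?W\<^esub> \<phi> (c a)"
      unfolding w wreath_product_factorization[OF D.is_group G(1) f a] c_def[symmetric]
      by (rule hom_mult[OF hom f' a'])
    then have "?p w = ?p (\<phi> (f, \<one>\<^bsub>G\<^esub>)) \<otimes>\<^bsub>?Q\<^esub> ?p (\<phi> (c a))"
      using hom_mult[OF p_hom hom_in_carrier[OF hom f'] hom_in_carrier[OF hom a']] by metis
    also have "?p (\<phi> (f, \<one>\<^bsub>G\<^esub>)) = \<one>\<^bsub>?Q\<^esub>" by (rule p_N) (use f in \<open>auto simp: N_def\<close>)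
    also have "\<one>\<^bsub>?Q\<^esub> \<otimes>\<^bsub>?Q\<^esub> ?p (\<phi> (c a)) = ?p (\<phi> (c a))"
      using hom_in_carrier[OF p_hom hom_in_carrier[OF hom a']] Q by (intro monoid.l_one group.is_monoid)
    finally show ?thesis using a by auto
  qed
  then have "(?p \<circ> (\<phi> \<circ> c)) ` carrier G = carrier ?Q"
    using hom_in_carrier[OF q_hom] unfolding carrier_FactGroup by blast
  then have Q_solvable: "solvable ?Q"
    using group_hom.surj_hom_imp_solvable[of G ?Q] G Q q_hom
    by (metis group_hom.intro group_hom_axioms.intro)
  have base: "?p \<circ> (\<lambda>f. (f, \<one>\<^bsub>G\<^esub>)) \<in> hom ?P ?Q"
    by (rule Group.hom_compose[OF wreath_base_hom[OF D.is_group G(1)] p_hom])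
  have "(?p \<circ> (\<lambda>f. (f, \<one>\<^bsub>G\<^esub>))) s = \<one>\<^bsub>?Q\<^esub>"
  proof (rule D.hom_trivial_on_singles[OF Q base _ s])
    fix x d assume "x \<in> carrier G" "d \<in> carrier D"
    then show "(?p \<circ> (\<lambda>f. (f, \<one>\<^bsub>G\<^esub>))) (single (carrier G) D x d) = \<one>\<^bsub>?Q\<^esub>"
      using hom_simple_unsolvable_to_solvable_trivial[OF D Q Q_solvable
          Group.hom_compose[OF D.single_hom base]] by (metis comp_apply)
  qed
  then have "?p (s, \<one>\<^bsub>G\<^esub>) = N" by simp
  then have "(s, \<one>\<^bsub>G\<^esub>) \<in> N"
    using W.coset_join1[OF _ _ N.subgroup_axioms] s by (simp add: wreath_product_carrier)
  then show ?thesis by (force simp: N_def)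
qed

text \<open>The base is generated by copies of \<open>D\<close>, and these have no nontrivial homomorphism to \<open>G\<close>.\<close>

lemma wreath_base_preserved:
  assumes D: "simple_group D" "\<not> solvable D" and G: "group G" "solvable G"
    and \<phi>: "\<phi> \<in> hom (wreath_product D G) (wreath_product D G)"
    and f: "f \<in> carrier (restricted_power (carrier G) D)"
  shows "snd (\<phi> (f, \<one>\<^bsub>G\<^esub>)) = \<one>\<^bsub>G\<^esub>"
proof -
  interpret D: simple_group D by (rule D)
  let ?h = "snd \<circ> (\<phi> \<circ> (\<lambda>f. (f, \<one>\<^bsub>G\<^esub>)))"
  have h: "?h \<in> hom (restricted_power (carrier G) D) G"
    by (intro Group.hom_compose[OF Group.hom_compose[OF wreath_base_hom \<phi>] wreath_quotient_hom] D.is_group G)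
  have "?h f = \<one>\<^bsub>G\<^esub>"
  proof (rule D.hom_trivial_on_singles[OF G(1) h _ f])
    fix x d assume "x \<in> carrier G" "d \<in> carrier D"
    then show "?h (single (carrier G) D x d) = \<one>\<^bsub>G\<^esub>"
      using hom_simple_unsolvable_to_solvable_trivial[OF D G Group.hom_compose[OF D.single_hom h]]
      by (metis comp_apply)
  qed
  then show ?thesis by simp
qed

text \<open>A surjection \<open>\<phi>\<close> restricts to a surjection of the base onto itself; its value at the identity
  of \<open>G\<close> is a surjection \<open>h\<close> from the base to \<open>D\<close>, which reads exactly one coordinate \<open>t\<close>.

  Let \<open>(f, a)\<close> be in the kernel of \<open>\<phi>\<close>. Conjugation by \<open>(f, a)\<close> does not change images under \<open>\<phi>\<close>,
  but moves the coordinate \<open>t\<close> to \<open>a t\<close>; since \<open>h\<close> sees \<open>t\<close> and not \<open>a t\<close> if these differ, \<open>a\<close> is the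
  identity. The kernel is normal, so it contains all translates of \<open>f\<close>; since \<open>h\<close> kills them, each
  of them is trivial at \<open>t\<close>, and these values are all the values of \<open>f\<close>.\<close>

theorem hopfian_wreath_product:
  assumes D: "simple_group D" "\<not> solvable D" and G: "group G" "solvable G"
  shows "hopfian (wreath_product D G)"
  unfolding hopfian_def
proof
  let ?W = "wreath_product D G" and ?P = "restricted_power (carrier G) D"
  interpret D: simple_group D by (rule D)
  interpret G: group G by (rule G)
  interpret P: group ?P by (rule D.restricted_power_is_group)
  interpret W: group ?W by (rule group_wreath_product[OF D.is_group G(1)])
  fix \<phi> assume \<phi>: "\<phi> \<in> epi ?W ?W"
  have hom: "\<phi> \<in> hom ?W ?W" and surj: "\<phi> ` carrier ?W = carrier ?W"
    using \<phi> by (auto simp: epi_def)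
  interpret \<phi>: group_hom ?W ?W \<phi>
    using hom by (simp add: group_hom_def group_hom_axioms_def W.is_group)
  define \<beta> where "\<beta> f = fst (\<phi> (f, \<one>\<^bsub>G\<^esub>))" for f
  have base_closed: "(f, \<one>\<^bsub>G\<^esub>) \<in> carrier ?W" if "f \<in> carrier ?P" for f
    using that by (simp add: wreath_product_carrier)
  have \<phi>_base: "\<phi> (f, \<one>\<^bsub>G\<^esub>) = (\<beta> f, \<one>\<^bsub>G\<^esub>)" if "f \<in> carrier ?P" for f
    unfolding \<beta>_def using wreath_base_preserved[OF D G hom that] by (metis prod.collapse)
  have \<beta>_closed: "\<beta> f \<in> carrier ?P" if "f \<in> carrier ?P" for f
    using \<phi>.hom_closed[OF base_closed[OF that]] \<phi>_base[OF that]
    by (simp add: wreath_product_carrier)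
  have "\<beta> (f \<otimes>\<^bsub>?P\<^esub> g) = \<beta> f \<otimes>\<^bsub>?P\<^esub> \<beta> g" if f: "f \<in> carrier ?P" and g: "g \<in> carrier ?P" for f g
  proof -
    have mult: "(f \<otimes>\<^bsub>?P\<^esub> g, \<one>\<^bsub>G\<^esub>) = (f, \<one>\<^bsub>G\<^esub>) \<otimes>\<^bsub>?W\<^esub> (g, \<one>\<^bsub>G\<^esub>)" if "f \<in> carrier ?P" "g \<in> carrier ?P" for f g
      using hom_mult[OF wreath_base_hom[OF D.is_group G(1)] that] .
    have "(\<beta> (f \<otimes>\<^bsub>?P\<^esub> g), \<one>\<^bsub>G\<^esub>) = (\<beta> f \<otimes>\<^bsub>?P\<^esub> \<beta> g, \<one>\<^bsub>G\<^esub>)"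
      using \<phi>.hom_mult[OF base_closed[OF f] base_closed[OF g]]
        \<phi>_base[OF P.m_closed[OF f g]] \<phi>_base[OF f] \<phi>_base[OF g]
        mult[OF f g] mult[OF \<beta>_closed[OF f] \<beta>_closed[OF g]] by metis
    then show ?thesis by blast
  qed
  then have \<beta>_hom: "\<beta> \<in> hom ?P ?P" using \<beta>_closed by (intro homI)
  define h where "h f = \<beta> f \<one>\<^bsub>G\<^esub>" for f
  have eval: "(\<lambda>f. f \<one>\<^bsub>G\<^esub>) \<in> hom ?P D"
    by (rule homI) (auto simp: D.restricted_power_carrier_iff)
  have h_hom: "h \<in> hom ?P D"
    using Group.hom_compose[OF \<beta>_hom eval] by (simp add: h_def[abs_def] comp_def)
  have "d \<in> h ` carrier ?P" if d: "d \<in> carrier D" for d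
  proof -
    have s: "single (carrier G) D \<one>\<^bsub>G\<^esub> d \<in> carrier ?P"
      using d by (intro D.single_in_carrier) auto
    obtain f where f: "f \<in> carrier ?P" "\<phi> (f, \<one>\<^bsub>G\<^esub>) = (single (carrier G) D \<one>\<^bsub>G\<^esub> d, \<one>\<^bsub>G\<^esub>)"
      using base_in_range_of_surjection[OF D G \<phi> s] by blast
    have "h f = d" using f by (simp add: h_def \<beta>_def single_def)
    then show ?thesis using f(1) by blast
  qed
  then have h_epi: "h \<in> epi ?P D"
    using h_hom hom_in_carrier[OF h_hom] by (auto simp: epi_def)
  obtain t where t: "t \<in> carrier G"
    and h_iff: "\<And>f. f \<in> carrier ?P \<Longrightarrow> h f = \<one>\<^bsub>D\<^esub> \<longleftrightarrow> f t = \<one>\<^bsub>D\<^esub>"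
    using surjection_from_power_is_coordinate[OF D h_epi] by blast
  have "w = \<one>\<^bsub>?W\<^esub>" if w: "w \<in> carrier ?W" "\<phi> w = \<one>\<^bsub>?W\<^esub>" for w
  proof -
    obtain f a where wfa: "w = (f, a)" and f: "f \<in> carrier ?P" and a: "a \<in> carrier G"
      using w(1) by (auto simp: wreath_product_carrier)
    have [simp]: "f x \<in> carrier D" if "x \<in> carrier G" for x
      using f that by (simp add: D.restricted_power_carrier_iff)
    have "a = \<one>\<^bsub>G\<^esub>"
    proof (rule ccontr)
      assume "a \<noteq> \<one>\<^bsub>G\<^esub>"
      then have at: "a \<otimes>\<^bsub>G\<^esub> t \<in> carrier G" "a \<otimes>\<^bsub>G\<^esub> t \<noteq> t" using a t by auto
      obtain d where d: "d \<in> carrier D" "d \<noteq> \<one>\<^bsub>D\<^esub>" using D.simple_not_triv D.one_closed by blast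
      \<comment> \<open>Chosen so that \<open>(f, a)\<close> conjugates \<open>d\<close> at \<open>t\<close> to \<open>e\<close> at \<open>a t\<close>.\<close>
      define e where "e = f (a \<otimes>\<^bsub>G\<^esub> t) \<otimes>\<^bsub>D\<^esub> d \<otimes>\<^bsub>D\<^esub> inv\<^bsub>D\<^esub> f (a \<otimes>\<^bsub>G\<^esub> t)"
      have e: "e \<in> carrier D" using at d by (simp add: e_def)
      let ?u = "single (carrier G) D t d" and ?v = "single (carrier G) D (a \<otimes>\<^bsub>G\<^esub> t) e"
      have u: "?u \<in> carrier ?P" by (rule D.single_in_carrier[OF t d(1)])
      have v: "?v \<in> carrier ?P" by (rule D.single_in_carrier[OF at(1) e])
      have "f \<otimes>\<^bsub>?P\<^esub> translate G a ?u = ?v \<otimes>\<^bsub>?P\<^esub> f"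
        unfolding translate_single[OF G(1) a t]
        using a t d at by (auto simp: single_def fun_eq_iff e_def D.m_assoc)
      then have "(f, a) \<otimes>\<^bsub>?W\<^esub> (?u, \<one>\<^bsub>G\<^esub>) = (?v, \<one>\<^bsub>G\<^esub>) \<otimes>\<^bsub>?W\<^esub> (f, a)"
        using a f by (simp add: wreath_product_mult translate_one[OF G(1)] D.restricted_power_carrier_iff)
      then have "\<phi> (f, a) \<otimes>\<^bsub>?W\<^esub> \<phi> (?u, \<one>\<^bsub>G\<^esub>) = \<phi> (?v, \<one>\<^bsub>G\<^esub>) \<otimes>\<^bsub>?W\<^esub> \<phi> (f, a)"
        using \<phi>.hom_mult[OF w(1) base_closed[OF u]] \<phi>.hom_mult[OF base_closed[OF v] w(1)]
        unfolding wfa by argo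
      then have "\<phi> (?u, \<one>\<^bsub>G\<^esub>) = \<phi> (?v, \<one>\<^bsub>G\<^esub>)"
        unfolding w(2)[unfolded wfa]
        using W.l_one[OF \<phi>.hom_closed[OF base_closed[OF u]]]
          W.r_one[OF \<phi>.hom_closed[OF base_closed[OF v]]] by argo
      then have "h ?u = h ?v" by (simp add: h_def \<beta>_def)
      moreover have "h ?v = \<one>\<^bsub>D\<^esub>" using h_iff[OF v] t at(2) by (simp add: single_def)
      ultimately have "?u t = \<one>\<^bsub>D\<^esub>" using h_iff[OF u] by simp
      then show False using d t by (simp add: single_def)
    qed
    have "f y = \<one>\<^bsub>D\<^esub>" if y: "y \<in> carrier G" for y
    proof -
      \<comment> \<open>Translation by \<open>b\<close> moves the value of \<open>f\<close> at \<open>y\<close> to the coordinate \<open>t\<close> that \<open>h\<close> reads.\<close>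
      define b where "b = t \<otimes>\<^bsub>G\<^esub> inv\<^bsub>G\<^esub> y"
      have b: "b \<in> carrier G" using t y by (simp add: b_def)
      let ?c = "(\<one>\<^bsub>?P\<^esub>, b)"
      have c: "?c \<in> carrier ?W" using b P.one_closed by (simp add: wreath_product_carrier del: one_sum_group)
      have tf: "translate G b f \<in> carrier ?P" by (rule translate_closed[OF D.is_group G(1) b f])
      have "?c \<otimes>\<^bsub>?W\<^esub> (f, \<one>\<^bsub>G\<^esub>) = (translate G b f, b)"
        using b P.l_one[OF tf] by (simp add: wreath_product_mult del: one_sum_group mult_sum_group)
      then have "?c \<otimes>\<^bsub>?W\<^esub> (f, \<one>\<^bsub>G\<^esub>) = (translate G b f, \<one>\<^bsub>G\<^esub>) \<otimes>\<^bsub>?W\<^esub> ?c"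
        using wreath_product_factorization[OF D.is_group G(1) tf b] by argo
      then have "\<phi> ?c \<otimes>\<^bsub>?W\<^esub> \<phi> (f, \<one>\<^bsub>G\<^esub>) = \<phi> (translate G b f, \<one>\<^bsub>G\<^esub>) \<otimes>\<^bsub>?W\<^esub> \<phi> ?c"
        using \<phi>.hom_mult[OF c base_closed[OF f]] \<phi>.hom_mult[OF base_closed[OF tf] c] by argo
      moreover have "\<phi> (f, \<one>\<^bsub>G\<^esub>) = \<one>\<^bsub>?W\<^esub>" using w(2) wfa \<open>a = \<one>\<^bsub>G\<^esub>\<close> by simp
      ultimately have "\<phi> ?c = \<phi> (translate G b f, \<one>\<^bsub>G\<^esub>) \<otimes>\<^bsub>?W\<^esub> \<phi> ?c"
        using W.r_one[OF \<phi>.hom_closed[OF c]] by argo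
      then have "\<phi> (translate G b f, \<one>\<^bsub>G\<^esub>) = \<one>\<^bsub>?W\<^esub>"
        using W.r_cancel_one'[OF \<phi>.hom_closed[OF c] \<phi>.hom_closed[OF base_closed[OF tf]]] by blast
      then have "h (translate G b f) = \<one>\<^bsub>D\<^esub>" by (simp add: h_def \<beta>_def wreath_product_one)
      then have "translate G b f t = \<one>\<^bsub>D\<^esub>" using h_iff[OF tf] by simp
      then show ?thesis
        using t y by (simp add: translate_def b_def G.inv_mult_group G.m_assoc)
    qed
    then have "f = \<one>\<^bsub>?P\<^esub>" using f by (auto simp: D.restricted_power_carrier_iff extensional_def)
    then show ?thesis using wfa \<open>a = \<one>\<^bsub>G\<^esub>\<close> by (simp add: wreath_product_one)
  qed
  then show "\<phi> \<in> iso ?W ?W" using \<phi>.iso_iff surj by blast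
qed

section \<open>Transport along isomorphisms\<close>

lemma countable_group_iso_nat:
  assumes G: "group G" and "countable (carrier G)"
  shows "\<exists>(H :: nat monoid) \<psi>. group H \<and> \<psi> \<in> iso G H"
proof -
  interpret G: group G by (rule G)
  let ?e = "to_nat_on (carrier G)"
  have inj: "inj_on ?e (carrier G)" using assms(2) by (rule inj_on_to_nat_on)
  have "weak_group_morphism ?e {\<one>\<^bsub>G\<^esub>} G"
  proof (rule weak_group_morphismsI[OF G.one_is_normal])
    fix a b assume ab: "a \<in> carrier G" "b \<in> carrier G"
    have "a \<otimes>\<^bsub>G\<^esub> inv\<^bsub>G\<^esub> b = \<one>\<^bsub>G\<^esub> \<longleftrightarrow> a = b"
      using ab by (metis G.inv_closed G.inv_equality G.inv_inv G.r_inv)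
    then show "?e a = ?e b \<longleftrightarrow> a \<otimes>\<^bsub>G\<^esub> inv\<^bsub>G\<^esub> b \<in> {\<one>\<^bsub>G\<^esub>}"
      using inj_on_eq_iff[OF inj ab] by simp
  qed
  then have "group (image_group ?e G)" "?e \<in> hom G (image_group ?e G)"
    by (rule G.image_group_is_group, rule G.weak_group_morphism_is_hom)
  then show ?thesis
    using inj by (intro exI[of _ "image_group ?e G"] exI[of _ ?e])
      (simp add: iso_def bij_betw_def image_group_carrier)
qed

lemma solvable_if_iso:
  assumes "group G" "group H" "\<psi> \<in> iso G H" "solvable G"
  shows "solvable H"
proof -
  interpret group_hom G H \<psi>
    using assms by (simp add: group_hom_def group_hom_axioms_def iso_def)
  show ?thesis using surj_hom_imp_solvable assms by (simp add: iso_def bij_betw_def)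
qed

lemma finitely_generated_if_iso:
  assumes "group G" "group H" "\<psi> \<in> iso G H" "finitely_generated G"
  shows "finitely_generated H"
proof -
  interpret group_hom G H \<psi>
    using assms by (simp add: group_hom_def group_hom_axioms_def iso_def)
  obtain S where S: "finite S" "S \<subseteq> carrier G" "generate G S = carrier G"
    using assms(4) by (auto simp: finitely_generated_def)
  have "generate H (\<psi> ` S) = \<psi> ` carrier G" using generate_img[OF S(2)] S(3) by simp
  then have "generate H (\<psi> ` S) = carrier H" using assms(3) by (simp add: iso_def bij_betw_def)
  moreover have "\<psi> ` S \<subseteq> carrier H" using S(2) hom_closed by blast
  ultimately show ?thesis using S(1) unfolding finitely_generated_def by blast
qed

lemma hopfian_if_iso:
  assumes G: "group G" and H: "group H" and \<psi>: "\<psi> \<in> iso G H" and hopf: "hopfian H"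
  shows "hopfian G"
  unfolding hopfian_def
proof
  interpret G: group G by (rule G)
  interpret H: group H by (rule H)
  fix h assume h: "h \<in> epi G G"
  define \<psi>' where "\<psi>' = inv_into (carrier G) \<psi>"
  have \<psi>': "\<psi>' \<in> iso H G" unfolding \<psi>'_def by (rule G.iso_set_sym[OF \<psi>])
  have epi: "f \<in> epi A B" if "f \<in> iso A B" for f and A :: "('e, 'f) monoid_scheme" and B :: "('g, 'h) monoid_scheme"
    using that by (auto simp: iso_def epi_def bij_betw_def)
  have "\<psi> \<circ> (h \<circ> \<psi>') \<in> epi H H"
    using epi_compose[OF epi_compose[OF epi[OF \<psi>'] h] epi[OF \<psi>]] .
  then have "\<psi> \<circ> (h \<circ> \<psi>') \<in> iso H H" using hopf by (auto simp: hopfian_def)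
  then have iso: "\<psi>' \<circ> ((\<psi> \<circ> (h \<circ> \<psi>')) \<circ> \<psi>) \<in> iso G G"
    by (intro iso_set_trans[OF iso_set_trans[OF \<psi>] \<psi>'])
  have eq: "(\<psi>' \<circ> ((\<psi> \<circ> (h \<circ> \<psi>')) \<circ> \<psi>)) x = h x" if "x \<in> carrier G" for x
  proof -
    have "\<psi>' (\<psi> y) = y" if "y \<in> carrier G" for y
      using \<psi> that by (simp add: \<psi>'_def iso_def bij_betw_def)
    moreover have "h x \<in> carrier G" using h that by (auto simp: epi_def)
    ultimately show ?thesis using that by simp
  qed
  show "h \<in> iso G G"
    using iso h bij_betw_cong[of "carrier G", OF eq] by (auto simp: iso_def epi_def)
qed

section \<open>Existence of a simple unsolvable group\<close>

lemma solvable_if_normal_and_quotient_solvable: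
  assumes G: "group G" and N: "N \<lhd> G"
    and "solvable (G\<lparr>carrier := N\<rparr>)" "solvable (G Mod N)"
  shows "solvable G"
proof -
  interpret G: group G by (rule G)
  interpret N: normal N G by (rule N)
  have sub: "group (G\<lparr>carrier := N\<rparr>)" by (rule N.subgroup_is_group[OF G])
  have quot: "group (G Mod N)" by (rule N.factorgroup_is_group)
  have "group_hom (G\<lparr>carrier := N\<rparr>) G id"
    using sub G N.subset by (auto simp: group_hom_def group_hom_axioms_def hom_def)
  moreover have "group_hom G (G Mod N) (r_coset G N)"
    using quot G N.r_coset_hom_Mod by (simp add: group_hom_def group_hom_axioms_def)
  moreover have "r_coset G N ` carrier G = carrier (G Mod N)" by (simp add: carrier_FactGroup)
  moreover have "kernel G (G Mod N) (r_coset G N) \<subseteq> id ` carrier (G\<lparr>carrier := N\<rparr>)"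
    using G.coset_join1[OF _ _ N.subgroup_axioms] N.subset by (auto simp: kernel_def)
  ultimately show ?thesis using assms(3,4) by (rule solvable_condition)
qed

text \<open>An unsolvable finite group of least order is simple: a proper nontrivial normal subgroup and its
  quotient are smaller, hence solvable, which makes the group solvable. The alternating group of
  degree 5 shows that finite unsolvable groups exist. To compare a group with its subgroups and
  quotients, which live on other types, least order is taken over groups on the natural numbers,
  and every finite group has a copy there.\<close>

lemma exists_simple_unsolvable_group:
  "\<exists>D :: nat monoid. simple_group D \<and> \<not> solvable D"
proof -
  define P where "P n \<longleftrightarrow> (\<exists>D :: nat monoid. group D \<and> finite (carrier D) \<and> order D = n \<and> \<not> solvable D)" for n
  have transport: "P (order G)" if G: "group G" and fin: "finite (carrier G)" and uns: "\<not> solvable G" for G :: "('g, 'm) monoid_scheme"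
  proof -
    obtain H :: "nat monoid" and \<psi> where H: "group H" "\<psi> \<in> iso G H"
      using countable_group_iso_nat[OF G countable_finite[OF fin]] by blast
    interpret G: group G by (rule G)
    have "carrier H = \<psi> ` carrier G" using H(2) by (auto simp: iso_def bij_betw_def)
    then have "finite (carrier H)" using fin by simp
    moreover have "order H = order G"
      using iso_same_order[OF H(2)] by simp
    moreover have "\<not> solvable H"
      using solvable_if_iso[OF H(1) G G.iso_set_sym[OF H(2)]] uns by blast
    ultimately show ?thesis using H(1) unfolding P_def by blast
  qed
  have "finite (carrier (alt_group 5))"
  proof (rule finite_subset)
    show "carrier (alt_group 5) \<subseteq> {p. p permutes {1..5}}" by (auto simp: alt_group_carrier)
  qed (simp add: finite_permutations)
  then have "P (order (alt_group 5))"
    using transport[OF alt_group_is_group[of 5]] alt_group_is_unsolvable[of 5] by simp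
  then have "P (LEAST n. P n)" by (rule LeastI)
  then obtain D :: "nat monoid" where D: "group D" "finite (carrier D)" "order D = (LEAST n. P n)" "\<not> solvable D"
    unfolding P_def by blast
  have minimal: "solvable G" if "group G" "finite (carrier G)" "order G < order D"
    for G :: "('g, 'm) monoid_scheme"
    using transport[OF that(1,2)] not_less_Least[of "order G" P] that(3) D(3) by auto
  interpret D: group D by (rule D)
  have "simple_group D"
  proof
    show "1 < order D"
    proof (rule ccontr)
      assume "\<not> 1 < order D"
      then have "order D = 1" using D.order_gt_0_iff_finite D(2) by simp
      then have "carrier D = {\<one>\<^bsub>D\<^esub>}" using D.order_one_triv_iff by blast
      then have "(derived D ^^ 0) (carrier D) = {\<one>\<^bsub>D\<^esub>}" by simp
      then show False using D.solvable_iff_trivial_derived_seq D(4) by blast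
    qed
    fix N assume N: "N \<lhd> D"
    interpret N: normal N D by (rule N)
    show "N = carrier D \<or> N = {\<one>\<^bsub>D\<^esub>}"
    proof (rule ccontr)
      assume "\<not> ?thesis"
      then have ne: "N \<noteq> carrier D" "N \<noteq> {\<one>\<^bsub>D\<^esub>}" by auto
      have fin: "finite N" using N.subset D(2) finite_subset by blast
      have less: "card N < order D"
        unfolding order_def using N.subset ne(1) D(2) by (simp add: psubset_card_mono psubset_eq)
      have "{\<one>\<^bsub>D\<^esub>} \<subset> N" using ne(2) N.one_closed by blast
      then have gt: "1 < card N" using psubset_card_mono[OF fin, of "{\<one>\<^bsub>D\<^esub>}"] by simp
      have lagrange: "card (rcosets\<^bsub>D\<^esub> N) * card N = order D"
        by (rule D.lagrange[OF N.subgroup_axioms])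
      have "0 < card (rcosets\<^bsub>D\<^esub> N)"
        using lagrange less by (metis gr0I less_nat_zero_code mult_0)
      moreover from this have "card (rcosets\<^bsub>D\<^esub> N) < order D"
        using mult_less_mono2[OF gt, of "card (rcosets\<^bsub>D\<^esub> N)"] unfolding lagrange by simp
      moreover have "order (D Mod N) = card (rcosets\<^bsub>D\<^esub> N)" by (simp add: order_def FactGroup_def)
      ultimately have "order (D Mod N) < order D" "0 < order (D Mod N)" by simp_all
      then have "solvable (D Mod N)"
        using minimal[OF N.factorgroup_is_group] by (simp add: order_def card_gt_0_iff)
      moreover have "solvable (D\<lparr>carrier := N\<rparr>)"
        using minimal[OF N.subgroup_is_group[OF D(1)]] fin less by (simp add: order_def)
      ultimately show False
        using solvable_if_normal_and_quotient_solvable[OF D(1) N] D(4) by blast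
    qed
  qed
  then show ?thesis using D(4) by blast
qed

section \<open>Hall's solvable non-Hopfian group\<close>

definition dyadic :: "rat set" where
  "dyadic = {x. \<exists>k::nat. 2 ^ k * x \<in> \<int>}"

lemma dyadic_of_int [simp]: "of_int m \<in> dyadic"
  by (auto simp: dyadic_def intro: exI[of _ 0])

lemma dyadic_0 [simp]: "0 \<in> dyadic" and dyadic_1 [simp]: "1 \<in> dyadic"
  using dyadic_of_int[of 0] dyadic_of_int[of 1] by simp_all

lemma dyadic_add [simp]: "x \<in> dyadic \<Longrightarrow> y \<in> dyadic \<Longrightarrow> x + y \<in> dyadic"
proof -
  assume "x \<in> dyadic" "y \<in> dyadic"
  then obtain k l :: nat where kl: "2 ^ k * x \<in> \<int>" "2 ^ l * y \<in> \<int>" by (auto simp: dyadic_def)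
  have "2 ^ l * (2 ^ k * x) + 2 ^ k * (2 ^ l * y) \<in> \<int>"
    by (intro Ints_add Ints_mult[OF _ kl(1)] Ints_mult[OF _ kl(2)] Ints_power Ints_numeral)
  also have "2 ^ l * (2 ^ k * x) + 2 ^ k * (2 ^ l * y) = 2 ^ (k + l) * (x + y)"
    by (simp add: power_add algebra_simps)
  finally show ?thesis by (auto simp: dyadic_def)
qed

lemma dyadic_mult [simp]: "x \<in> dyadic \<Longrightarrow> y \<in> dyadic \<Longrightarrow> x * y \<in> dyadic"
proof -
  assume "x \<in> dyadic" "y \<in> dyadic"
  then obtain k l :: nat where kl: "2 ^ k * x \<in> \<int>" "2 ^ l * y \<in> \<int>" by (auto simp: dyadic_def)
  have "(2 ^ k * x) * (2 ^ l * y) \<in> \<int>" by (rule Ints_mult[OF kl])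
  also have "(2 ^ k * x) * (2 ^ l * y) = 2 ^ (k + l) * (x * y)"
    by (simp add: power_add algebra_simps)
  finally show ?thesis by (auto simp: dyadic_def)
qed

lemma dyadic_minus [simp]: "x \<in> dyadic \<Longrightarrow> - x \<in> dyadic"
  using dyadic_mult[OF dyadic_of_int[of "-1"]] by simp

lemma dyadic_diff [simp]: "x \<in> dyadic \<Longrightarrow> y \<in> dyadic \<Longrightarrow> x - y \<in> dyadic"
  using dyadic_add[OF _ dyadic_minus] by fastforce

lemma dyadic_half [simp]: "1 / 2 \<in> dyadic"
  by (auto simp: dyadic_def intro!: exI[of _ 1])

lemma dyadic_power_int [simp]: "2 powi n \<in> dyadic"
proof -
  have pos: "2 ^ k \<in> dyadic" for k
    using dyadic_of_int[of "2 ^ k"] by simp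
  have "inverse (2 ^ k) \<in> dyadic" for k
    by (auto simp: dyadic_def intro!: exI[of _ k])
  then show ?thesis using pos by (simp add: power_int_def power_one_over inverse_eq_divide)
qed

lemma dyadic_frac [simp]: "x \<in> dyadic \<Longrightarrow> frac x \<in> dyadic"
  unfolding frac_def using dyadic_add[OF _ dyadic_of_int[of "- \<lfloor>x\<rfloor>"]] by simp

lemma frac_eqI: "x - y \<in> \<int> \<Longrightarrow> frac x = frac (y :: rat)"
proof -
  assume "x - y \<in> \<int>"
  then obtain m where "x = y + of_int m" by (metis Ints_cases add.commute diff_add_cancel)
  then show ?thesis by (simp add: frac_def)
qed

text \<open>The tuple \<open>(n, a, b, c)\<close> stands for the upper triangular matrix with rows \<open>(1, a, c)\<close>,
  \<open>(0, 2^n, b)\<close>, \<open>(0, 0, 1)\<close> over the dyadic rationals, where the central entry \<open>c\<close> is taken modulo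
  the integers and represented in \<open>[0, 1)\<close>. This is P. Hall's group: the quotient of a matrix group
  by an infinite cyclic subgroup of its centre.\<close>

definition hall_mult :: "int \<times> rat \<times> rat \<times> rat \<Rightarrow> int \<times> rat \<times> rat \<times> rat \<Rightarrow> int \<times> rat \<times> rat \<times> rat" where
  "hall_mult = (\<lambda>(n, a, b, c) (n', a', b', c').
     (n + n', a' + a * 2 powi n', b + 2 powi n * b', frac (c + c' + a * b')))"

definition hall_group :: "(int \<times> rat \<times> rat \<times> rat) monoid" where
  "hall_group = \<lparr>carrier = UNIV \<times> dyadic \<times> dyadic \<times> {c \<in> dyadic. 0 \<le> c \<and> c < 1},
     monoid.mult = hall_mult, one = (0, 0, 0, 0)\<rparr>"

lemma hall_carrier:
  "(n, a, b, c) \<in> carrier hall_group \<longleftrightarrow> a \<in> dyadic \<and> b \<in> dyadic \<and> c \<in> dyadic \<and> 0 \<le> c \<and> c < 1"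
  by (auto simp: hall_group_def)

lemma hall_mult_simp:
  "(n, a, b, c) \<otimes>\<^bsub>hall_group\<^esub> (n', a', b', c') =
     (n + n', a' + a * 2 powi n', b + 2 powi n * b', frac (c + c' + a * b'))"
  by (simp add: hall_group_def hall_mult_def)

lemma hall_one: "\<one>\<^bsub>hall_group\<^esub> = (0, 0, 0, 0)"
  by (simp add: hall_group_def)

lemma frac_canonical [simp]: "0 \<le> c \<Longrightarrow> c < 1 \<Longrightarrow> frac c = (c :: rat)"
  by (simp add: frac_eq)

lemma frac_add_frac_left [simp]: "frac (frac x + y) = frac (x + y :: rat)"
  by (rule frac_eqI) (simp add: frac_def)

lemma frac_add_frac_right [simp]: "frac (x + frac y) = frac (x + y :: rat)"
  by (rule frac_eqI) (simp add: frac_def)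

lemma frac_diff_frac_left [simp]: "frac (frac x - y) = frac (x - y :: rat)"
  by (rule frac_eqI) (simp add: frac_def)

lemma hall_is_group: "group hall_group"
proof (rule groupI)
  fix x y assume "x \<in> carrier hall_group" "y \<in> carrier hall_group"
  then show "x \<otimes>\<^bsub>hall_group\<^esub> y \<in> carrier hall_group"
    by (cases x; cases y) (simp add: hall_carrier hall_mult_simp frac_lt_1)
next
  show "\<one>\<^bsub>hall_group\<^esub> \<in> carrier hall_group" by (simp add: hall_carrier hall_one)
next
  fix x y z :: "int \<times> rat \<times> rat \<times> rat"
  obtain n a b c where x: "x = (n, a, b, c)" by (cases x)
  obtain n' a' b' c' where y: "y = (n', a', b', c')" by (cases y)
  obtain n'' a'' b'' c'' where z: "z = (n'', a'', b'', c'')" by (cases z)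
  have "frac (frac (c + c' + a * b') + c'' + (a' + a * 2 powi n') * b'') =
      frac (c + frac (c' + c'' + a' * b'') + a * (b' + 2 powi n' * b''))"
    by (rule frac_eqI) (simp add: frac_def algebra_simps)
  then show "x \<otimes>\<^bsub>hall_group\<^esub> y \<otimes>\<^bsub>hall_group\<^esub> z = x \<otimes>\<^bsub>hall_group\<^esub> (y \<otimes>\<^bsub>hall_group\<^esub> z)"
    unfolding x y z hall_mult_simp by (simp only: prod.inject) (simp add: power_int_add algebra_simps)
next
  fix x assume "x \<in> carrier hall_group"
  then show "\<one>\<^bsub>hall_group\<^esub> \<otimes>\<^bsub>hall_group\<^esub> x = x"
    by (cases x) (simp add: hall_carrier hall_mult_simp hall_one)
next
  fix x assume x: "x \<in> carrier hall_group"
  obtain n a b c where abc: "x = (n, a, b, c)" by (cases x)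
  let ?y = "(- n, - (a * 2 powi (- n)), - (2 powi (- n) * b), frac (- c + a * (2 powi (- n) * b)))"
  have "?y \<in> carrier hall_group"
    using x by (simp add: abc hall_carrier frac_lt_1)
  moreover have "?y \<otimes>\<^bsub>hall_group\<^esub> x = \<one>\<^bsub>hall_group\<^esub>"
  proof -
    have "frac (frac (- c + a * (2 powi (- n) * b)) + c + - (a * 2 powi (- n)) * b) = frac 0"
      by (rule frac_eqI) (simp add: frac_def algebra_simps)
    moreover have "2 powi (- n) * 2 powi n = (1 :: rat)"
      by (simp add: power_int_minus)
    ultimately show ?thesis
      by (simp add: abc hall_mult_simp hall_one mult.assoc)
  qed
  ultimately show "\<exists>y\<in>carrier hall_group. y \<otimes>\<^bsub>hall_group\<^esub> x = \<one>\<^bsub>hall_group\<^esub>" by blast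
qed

text \<open>Conjugation by the diagonal matrix with entries \<open>2, 1, 1\<close> doubles \<open>a\<close> and \<open>c\<close>. It maps integers
  to integers, so it acts on the quotient; it is onto because dyadic rationals are divisible by 2,
  but it kills the class of \<open>1/2\<close> in the centre.\<close>

lemma hall_not_hopfian: "\<not> hopfian hall_group"
proof
  assume hopf: "hopfian hall_group"
  define h :: "int \<times> rat \<times> rat \<times> rat \<Rightarrow> int \<times> rat \<times> rat \<times> rat"
    where "h = (\<lambda>(n, a, b, c). (n, 2 * a, b, frac (2 * c)))"
  have closed: "h x \<in> carrier hall_group" if "x \<in> carrier hall_group" for x
    using that dyadic_of_int[of 2] by (cases x) (simp add: h_def hall_carrier frac_lt_1)
  have "h (x \<otimes>\<^bsub>hall_group\<^esub> y) = h x \<otimes>\<^bsub>hall_group\<^esub> h y" for x y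
  proof -
    obtain n a b c where x: "x = (n, a, b, c)" by (cases x)
    obtain n' a' b' c' where y: "y = (n', a', b', c')" by (cases y)
    have "frac (2 * frac (c + c' + a * b')) = frac (frac (2 * c) + frac (2 * c') + (2 * a) * b')"
      by (rule frac_eqI) (simp add: frac_def algebra_simps)
    then show ?thesis
      unfolding x y by (simp add: h_def hall_mult_simp algebra_simps)
  qed
  then have hom: "h \<in> hom hall_group hall_group" using closed by (intro homI)
  have "x \<in> h ` carrier hall_group" if x: "x \<in> carrier hall_group" for x
  proof -
    obtain n a b c where abc: "x = (n, a, b, c)" by (cases x)
    have "(n, a * (1 / 2), b, c * (1 / 2)) \<in> carrier hall_group"
      using x dyadic_mult[OF _ dyadic_half] unfolding abc hall_carrier by simp
    moreover have "h (n, a * (1 / 2), b, c * (1 / 2)) = x"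
      using x by (simp add: h_def abc hall_carrier)
    ultimately show ?thesis by (metis imageI)
  qed
  then have "h \<in> epi hall_group hall_group" using hom closed by (auto simp: epi_def)
  then have "inj_on h (carrier hall_group)" using hopf by (auto simp: hopfian_def iso_def bij_betw_def)
  moreover have "h (0, 0, 0, 1 / 2) = h (0, 0, 0, 0)" by (simp add: h_def frac_def)
  moreover have "(0, 0, 0, 1 / 2) \<in> carrier hall_group" "(0, 0, 0, 0) \<in> carrier hall_group"
    by (simp_all add: hall_carrier)
  ultimately have "(0 :: int, 0 :: rat, 0 :: rat, 1 / 2 :: rat) = (0, 0, 0, 0)" by (rule inj_onD)
  then show False by simp
qed

lemma hall_inv:
  assumes "(n, a, b, c) \<in> carrier hall_group"
  shows "inv\<^bsub>hall_group\<^esub> (n, a, b, c) =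
    (- n, - (a * 2 powi (- n)), - (2 powi (- n) * b), frac (a * (2 powi (- n) * b) - c))"
proof (rule group.inv_equality[OF hall_is_group _ assms])
  have "frac (frac (a * (2 powi (- n) * b) - c) + c - a * (2 powi (- n) * b)) = frac 0"
    by (rule frac_eqI) (simp add: frac_def)
  then show "(- n, - (a * 2 powi (- n)), - (2 powi (- n) * b), frac (a * (2 powi (- n) * b) - c))
      \<otimes>\<^bsub>hall_group\<^esub> (n, a, b, c) = \<one>\<^bsub>hall_group\<^esub>"
    by (simp add: hall_mult_simp hall_one mult.assoc power_int_minus)
qed (use assms in \<open>simp add: hall_carrier frac_lt_1\<close>)

lemma (in group) derived_subset:
  assumes "subgroup K G"
    and "\<And>x y. \<lbrakk>x \<in> H; y \<in> H\<rbrakk> \<Longrightarrow> x \<otimes> y \<otimes> inv x \<otimes> inv y \<in> K"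
  shows "derived G H \<subseteq> K"
  unfolding derived_def using assms by (intro generate_subgroup_incl) auto

text \<open>The derived series descends along the subgroup \<open>A\<close> of unitriangular matrices and the subgroup \<open>C\<close>
  in which only the central entry is left.\<close>

lemma hall_solvable: "solvable hall_group"
proof -
  interpret H: group hall_group by (rule hall_is_group)
  define A where "A = {x \<in> carrier hall_group. fst x = 0}"
  define C where "C = {x \<in> carrier hall_group. fst x = 0 \<and> fst (snd x) = 0 \<and> fst (snd (snd x)) = 0}"
  have A: "subgroup A hall_group"
  proof (rule H.subgroupI)
    show "A \<subseteq> carrier hall_group" by (auto simp: A_def)
    show "A \<noteq> {}" using H.one_closed by (auto simp: A_def hall_one)
    fix x y assume x: "x \<in> A" and y: "y \<in> A"
    show "inv\<^bsub>hall_group\<^esub> x \<in> A"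
      using x H.inv_closed[of x] by (cases x) (simp add: A_def hall_inv)
    show "x \<otimes>\<^bsub>hall_group\<^esub> y \<in> A"
      using x y H.m_closed[of x y] by (cases x; cases y) (simp add: A_def hall_mult_simp)
  qed
  have C: "subgroup C hall_group"
  proof (rule H.subgroupI)
    show "C \<subseteq> carrier hall_group" by (auto simp: C_def)
    show "C \<noteq> {}" using H.one_closed by (auto simp: C_def hall_one)
    fix x y assume x: "x \<in> C" and y: "y \<in> C"
    show "inv\<^bsub>hall_group\<^esub> x \<in> C"
      using x H.inv_closed[of x] by (cases x) (simp add: C_def hall_inv)
    show "x \<otimes>\<^bsub>hall_group\<^esub> y \<in> C"
      using x y H.m_closed[of x y] by (cases x; cases y) (simp add: C_def hall_mult_simp)
  qed
  have closed: "x \<otimes>\<^bsub>hall_group\<^esub> y \<otimes>\<^bsub>hall_group\<^esub> inv\<^bsub>hall_group\<^esub> x \<otimes>\<^bsub>hall_group\<^esub> inv\<^bsub>hall_group\<^esub> y \<in> carrier hall_group"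
    if "x \<in> carrier hall_group" "y \<in> carrier hall_group" for x y
    using that by simp
  have 1: "derived hall_group (carrier hall_group) \<subseteq> A"
  proof (rule H.derived_subset[OF A])
    fix x y assume "x \<in> carrier hall_group" "y \<in> carrier hall_group"
    then show "x \<otimes>\<^bsub>hall_group\<^esub> y \<otimes>\<^bsub>hall_group\<^esub> inv\<^bsub>hall_group\<^esub> x \<otimes>\<^bsub>hall_group\<^esub> inv\<^bsub>hall_group\<^esub> y \<in> A"
      using closed[of x y] unfolding A_def
      by (cases x; cases y) (simp add: hall_mult_simp hall_inv)
  qed
  have 2: "derived hall_group A \<subseteq> C"
  proof (rule H.derived_subset[OF C])
    fix x y assume "x \<in> A" "y \<in> A"
    then show "x \<otimes>\<^bsub>hall_group\<^esub> y \<otimes>\<^bsub>hall_group\<^esub> inv\<^bsub>hall_group\<^esub> x \<otimes>\<^bsub>hall_group\<^esub> inv\<^bsub>hall_group\<^esub> y \<in> C"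
      using closed[of x y] unfolding A_def C_def
      by (cases x; cases y) (simp add: hall_mult_simp hall_inv)
  qed
  have 3: "derived hall_group C \<subseteq> {\<one>\<^bsub>hall_group\<^esub>}"
  proof (rule H.derived_subset[OF H.triv_subgroup])
    fix x y assume "x \<in> C" "y \<in> C"
    then show "x \<otimes>\<^bsub>hall_group\<^esub> y \<otimes>\<^bsub>hall_group\<^esub> inv\<^bsub>hall_group\<^esub> x \<otimes>\<^bsub>hall_group\<^esub> inv\<^bsub>hall_group\<^esub> y \<in> {\<one>\<^bsub>hall_group\<^esub>}"
      unfolding C_def by (cases x; cases y) (simp add: hall_mult_simp hall_inv hall_one)
  qed
  have sub: "A \<subseteq> carrier hall_group" "C \<subseteq> carrier hall_group" by (auto simp: A_def C_def)
  have "(derived hall_group ^^ 3) (carrier hall_group) \<subseteq> {\<one>\<^bsub>hall_group\<^esub>}"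
    using 3 H.mono_derived[OF order.trans[OF H.mono_derived[OF 1] 2]]
    by (simp add: numeral_3_eq_3)
  moreover have "\<one>\<^bsub>hall_group\<^esub> \<in> (derived hall_group ^^ 3) (carrier hall_group)"
    by (intro subgroup.one_closed H.exp_of_derived_is_subgroup H.subgroup_self)
  ultimately have "(derived hall_group ^^ 3) (carrier hall_group) = {\<one>\<^bsub>hall_group\<^esub>}" by blast
  then show ?thesis using H.solvable_iff_trivial_derived_seq by blast
qed

text \<open>Conjugation by the diagonal generator multiplies the entries \<open>a\<close> and \<open>b\<close> by arbitrary powers of 2,
  so the two elementary generators yield all dyadic \<open>a\<close> and \<open>b\<close>. The commutator of the elements with
  entries \<open>a = c\<close> and \<open>b = 1\<close> is central with entry \<open>c\<close>.\<close>

lemma hall_finitely_generated: "finitely_generated hall_group"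
proof -
  interpret H: group hall_group by (rule hall_is_group)
  define S :: "(int \<times> rat \<times> rat \<times> rat) set" where "S = {(1, 0, 0, 0), (0, 1, 0, 0), (0, 0, 1, 0)}"
  define T where "T = generate hall_group S"
  have S: "S \<subseteq> carrier hall_group" by (simp add: S_def hall_carrier)
  interpret T: subgroup T hall_group unfolding T_def by (rule H.generate_is_subgroup[OF S])
  have gens: "(1, 0, 0, 0) \<in> T" "(0, 1, 0, 0) \<in> T" "(0, 0, 1, 0) \<in> T"
    by (auto simp: T_def S_def intro: generate.incl)
  have mult: "(n + n', a' + a * 2 powi n', b + 2 powi n * b', frac (c + c' + a * b')) \<in> T"
    if "(n, a, b, c) \<in> T" "(n', a', b', c') \<in> T" for n a b c n' a' b' c'
    using T.m_closed[OF that] by (simp add: hall_mult_simp)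
  have inv: "(- n, - (a * 2 powi (- n)), - (2 powi (- n) * b), frac (a * (2 powi (- n) * b) - c)) \<in> T"
    if "(n, a, b, c) \<in> T" for n a b c
    using T.m_inv_closed[OF that] unfolding hall_inv[OF T.mem_carrier[OF that]] .
  have t_nat: "(int k, 0, 0, 0) \<in> T" for k
  proof (induction k)
    case 0 then show ?case using T.one_closed by (simp add: hall_one)
  next
    case (Suc k)
    from mult[OF this gens(1)] show ?case by (simp add: add.commute)
  qed
  have t: "(n, 0, 0, 0) \<in> T" for n
  proof (cases "n \<ge> 0")
    case True then show ?thesis using t_nat[of "nat n"] by simp
  next
    case False then show ?thesis using inv[OF t_nat[of "nat (- n)"]] by simp
  qed
  have conj_a: "(0, a * 2 powi n, 0, 0) \<in> T" if "(0, a, 0, 0) \<in> T" for a n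
    using mult[OF mult[OF t[of "- n"] that] t[of n]] by simp
  have conj_b: "(0, 0, 2 powi n * b, 0) \<in> T" if "(0, 0, b, 0) \<in> T" for b n
    using mult[OF mult[OF t[of n] that] t[of "- n"]] by simp
  have a_nat: "(0, of_nat k, 0, 0) \<in> T" for k
  proof (induction k)
    case 0 then show ?case using T.one_closed by (simp add: hall_one)
  next
    case (Suc k)
    from mult[OF this gens(2)] show ?case by simp
  qed
  have b_nat: "(0, 0, of_nat k, 0) \<in> T" for k
  proof (induction k)
    case 0 then show ?case using T.one_closed by (simp add: hall_one)
  next
    case (Suc k)
    from mult[OF this gens(3)] show ?case by (simp add: add.commute)
  qed
  have a_int: "(0, of_int m, 0, 0) \<in> T" for m
    using a_nat[of "nat m"] inv[OF a_nat[of "nat (- m)"]] by (cases "m \<ge> 0") simp_all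
  have b_int: "(0, 0, of_int m, 0) \<in> T" for m
    using b_nat[of "nat m"] inv[OF b_nat[of "nat (- m)"]] by (cases "m \<ge> 0") simp_all
  have dyadic_form: "\<exists>m k. x = of_int m * 2 powi k \<and> x = 2 powi k * of_int m"
    if x: "x \<in> dyadic" for x
  proof -
    obtain k where "2 ^ k * x \<in> \<int>" using x by (auto simp: dyadic_def)
    then obtain m where "2 ^ k * x = of_int m" by (rule Ints_cases)
    then have "x = of_int m * 2 powi (- int k)" by (simp add: power_int_minus field_simps)
    then show ?thesis by (intro exI[of _ m] exI[of _ "- int k"]) (simp add: mult.commute)
  qed
  have a: "(0, a, 0, 0) \<in> T" if a: "a \<in> dyadic" for a
  proof -
    obtain m k where "a = of_int m * 2 powi k" using dyadic_form[OF a] by blast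
    then show ?thesis using conj_a[OF a_int[of m], of k] by (simp only:)
  qed
  have b: "(0, 0, b, 0) \<in> T" if b: "b \<in> dyadic" for b
  proof -
    obtain m k where "b = 2 powi k * of_int m" using dyadic_form[OF b] by blast
    then show ?thesis using conj_b[OF b_int[of m], of k] by (simp only:)
  qed
  have c: "(0, 0, 0, c) \<in> T" if "c \<in> dyadic" "0 \<le> c" "c < 1" for c
  proof -
    have "(0, c, 1, c) \<in> T" using mult[OF a[OF that(1)] gens(3)] that by simp
    from mult[OF this a[of "- c"]] that have "(0, 0, 1, c) \<in> T" by simp
    from mult[OF b[of "-1"] this] that show ?thesis by simp
  qed
  have "(n, a, b, c) \<in> T" if "(n, a, b, c) \<in> carrier hall_group" for n a b c
  proof -
    have abc: "a \<in> dyadic" "b \<in> dyadic" "c \<in> dyadic" "0 \<le> c" "c < 1"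
      using that by (simp_all add: hall_carrier)
    have "(n, a, b, 0) \<in> T" using mult[OF mult[OF b[OF abc(2)] t[of n]] a[OF abc(1)]] by simp
    from mult[OF this c[OF abc(3-5)]] abc show ?thesis by simp
  qed
  then have "carrier hall_group \<subseteq> T" by auto
  then have "generate hall_group S = carrier hall_group" using T.subset by (auto simp: T_def)
  then show ?thesis using S unfolding finitely_generated_def by (intro exI[of _ S]) (simp add: S_def)
qed

section \<open>The example\<close>

theorem theorem1p13:
  shows "\<exists>(\<Delta> :: nat monoid) (\<Gamma> :: nat monoid).
    group \<Delta> \<and> finitely_generated \<Delta> \<and>
    group \<Gamma> \<and> finitely_generated \<Gamma> \<and>
    \<not> hopfian \<Gamma> \<and> hopfian (wreath_product \<Delta> \<Gamma>)"
proof -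
  obtain D :: "nat monoid" where D: "simple_group D" "\<not> solvable D"
    using exists_simple_unsolvable_group by blast
  interpret D: simple_group D by (rule D)
  have "finite (carrier D)" using D.order_gt_one D.order_gt_0_iff_finite by simp
  then have "finitely_generated D"
    unfolding finitely_generated_def
    using D.generate_incl[of "carrier D"] generate.incl[of _ "carrier D" D]
    by (intro exI[of _ "carrier D"]) auto
  moreover obtain G :: "nat monoid" and \<psi> where G: "group G" and \<psi>: "\<psi> \<in> iso hall_group G"
    using countable_group_iso_nat[OF hall_is_group countableI_type] by blast
  note transport = hall_is_group G \<psi>
  moreover have "finitely_generated G"
    by (rule finitely_generated_if_iso[OF transport hall_finitely_generated])
  moreover have "\<not> hopfian G"
    using hopfian_if_iso[OF transport] hall_not_hopfian by blast
  moreover have "hopfian (wreath_product D G)"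
    by (rule hopfian_wreath_product[OF D G solvable_if_iso[OF transport hall_solvable]])
  ultimately show ?thesis using D.is_group by blast
qed

end
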